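(* Let $\alpha \in \mathbb{R}[t]\setminus\{0\}$ and let $\mathcal{A} \in \mathbb{H}[t]$ be reduced with respect to $\mathbf{i}$. Then the following two conditions are equivalent: 1. There exists a polynomial $\mathbf{b}\in \mathbb{H}[t]$ such that $\mathcal{C} = (\alpha + \varepsilon \mathbf{b})\mathcal{A}$ is a framing motion polynomial and the trajectory $\mathbf{r} = -2\alpha^{-1}\mathbf{b}$ of the origin is a rational non-polynomial PH curve. 2. There exists a (real or complex) root $z$ of $\alpha$, of multiplicity $n\ge 1$, such that the vectors $\mathbf{f}_0,\mathbf{f}_1,\ldots,\mathbf{f}_n$, defined by $\mathcal{A}\,\mathbf{i}\,\mathcal{A}^\ast = \sum_{i\ge 0} (t-z)^i\, \mathbf{f}_i$, are linearly dependent over $\mathbb{C}$. (The linear dependence condition is always satisfied if $n \ge 3$.)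
   Context: $\mathbb{H}$ is the real algebra of quaternions with basis $1,\mathbf{i},\mathbf{j},\mathbf{k}$; $\mathbb{H}[t]$ is the ring of polynomials with quaternion coefficients in an indeterminate $t$ commuting with all coefficients. $\ast$ denotes quaternion conjugation (applied coefficientwise to polynomials). A quaternion (polynomial) $\mathcal{B}$ is vectorial if $\mathcal{B}+\mathcal{B}^\ast=0$; vectorial quaternions $x_1\mathbf{i}+x_2\mathbf{j}+x_3\mathbf{k}$ are identified with vectors $(x_1,x_2,x_3)$. $\mathcal{A}\in\mathbb{H}[t]$ is reduced with respect to $\mathbf{i}$ if it has no real polynomial factor of positive degree and no polynomial right factor of positive degree with coefficients in the subalgebra of $\mathbb{H}$ generated by $1$ and $\mathbf{i}$ (in particular $\mathcal{A}\ne 0$). The dual quaternions are $\mathbb{H}+\varepsilon\mathbb{H}$ with $\varepsilon$ commuting with quaternions and $\varepsilon^2=0$. A motion polynomial is $\mathcal{P}+\varepsilon\mathcal{D}$ with $\mathcal{P},\mathcal{D}\in\mathbb{H}[t]$, $\mathcal{P}\ne0$, satisfying the Study condition $\mathcal{P}\mathcal{D}^\ast+\mathcal{D}\mathcal{P}^\ast=0$. Under the corresponding motion the trajectory of the origin is the rational curve $(\mathcal{P}\mathcal{D}^\ast-\mathcal{D}\mathcal{P}^\ast)/(\mathcal{P}\mathcal{P}^\ast)$; for $\mathcal{C}=(\alpha+\varepsilon\mathbf{b})\mathcal{A}$ with $\mathbf{b}$ vectorial it equals $\mathbf{r}=-2\alpha^{-1}\mathbf{b}$. A motion polynomial $\mathcal{C}=(\alpha+\varepsilon\mathbf{b})\mathcal{A}$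 is framing if $\mathcal{A}\,\mathbf{i}\,\mathcal{A}^\ast$ is tangent to the trajectory $\mathbf{r}$ of the origin, i.e. $\mathbf{r}'$ and $\mathcal{A}\,\mathbf{i}\,\mathcal{A}^\ast$ are linearly dependent over the field $\mathbb{R}(t)$. A rational curve $\mathbf{r}=(r_1,r_2,r_3)\in\mathbb{R}(t)^3$ is a rational PH curve if there is $\sigma\in\mathbb{R}(t)$ with $(r_1')^2+(r_2')^2+(r_3')^2=\sigma^2$. It is non-polynomial if $\mathbf{r}\notin\mathbb{R}[t]^3$. In condition 2, $\mathcal{A}\,\mathbf{i}\,\mathcal{A}^\ast$ is vectorial, viewed as an element of $\mathbb{R}[t]^3\subset\mathbb{C}[t]^3$; the $\mathbf{f}_i\in\mathbb{C}^3$ are its Taylor coefficients at $z$ (zero for $i$ larger than the degree), and linear dependence refers to the family $(\mathbf{f}_0,\dots,\mathbf{f}_n)$. *)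

theory Defs
  imports "HOL-Analysis.Analysis" "HOL-Computational_Algebra.Polynomial_Factorial"
begin

section \<open>Quaternions over a commutative ring\<close>

text \<open>
  \<open>Quat a b c d\<close> is $a + b\mathbf{i} + c\mathbf{j} + d\mathbf{k}$.  The scalars range over an arbitrary
  commutative ring: \<open>real quat\<close> is $\mathbb{H}$.  Since the indeterminate $t$ commutes with all
  coefficients, $\mathbb{H}[t]$ is the quaternion algebra over $\mathbb{R}[t]$, that is,
  \<open>real poly quat\<close> (the library only multiplies polynomials over commutative
  coefficient rings); see \<open>qcoeff\<close> and \<open>qcoeff_mult\<close> below.
\<close>

datatype 'a quat = Quat (qRe: 'a) (qIm1: 'a) (qIm2: 'a) (qIm3: 'a)

lemma quat_eq_iff:
  "p = q \<longleftrightarrow> qRe p = qRe q \<and> qIm1 p = qIm1 q \<and> qIm2 p = qIm2 q \<and> qIm3 p = qIm3 q"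
  by (cases p; cases q) auto

instantiation quat :: (comm_ring_1) ring_1
begin

definition zero_quat :: "'a quat" where "0 = Quat 0 0 0 0"

definition one_quat :: "'a quat" where "1 = Quat 1 0 0 0"

definition plus_quat :: "'a quat \<Rightarrow> 'a quat \<Rightarrow> 'a quat" where
  "p + q = Quat (qRe p + qRe q) (qIm1 p + qIm1 q) (qIm2 p + qIm2 q) (qIm3 p + qIm3 q)"

definition uminus_quat :: "'a quat \<Rightarrow> 'a quat" where
  "- p = Quat (- qRe p) (- qIm1 p) (- qIm2 p) (- qIm3 p)"

definition minus_quat :: "'a quat \<Rightarrow> 'a quat \<Rightarrow> 'a quat" where
  "p - q = Quat (qRe p - qRe q) (qIm1 p - qIm1 q) (qIm2 p - qIm2 q) (qIm3 p - qIm3 q)"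

definition times_quat :: "'a quat \<Rightarrow> 'a quat \<Rightarrow> 'a quat" where
  "p * q = Quat
    (qRe p * qRe q - qIm1 p * qIm1 q - qIm2 p * qIm2 q - qIm3 p * qIm3 q)
    (qRe p * qIm1 q + qIm1 p * qRe q + qIm2 p * qIm3 q - qIm3 p * qIm2 q)
    (qRe p * qIm2 q - qIm1 p * qIm3 q + qIm2 p * qRe q + qIm3 p * qIm1 q)
    (qRe p * qIm3 q + qIm1 p * qIm2 q - qIm2 p * qIm1 q + qIm3 p * qRe q)"

instance
  by standard
    (simp_all add: quat_eq_iff zero_quat_def one_quat_def plus_quat_def uminus_quat_def
      minus_quat_def times_quat_def algebra_simps)

end

definition quat_of :: "'a::comm_ring_1 \<Rightarrow> 'a quat" where
  "quat_of a = Quat a 0 0 0"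

definition quat_i :: "'a::comm_ring_1 quat" where "quat_i = Quat 0 1 0 0"
definition quat_j :: "'a::comm_ring_1 quat" where "quat_j = Quat 0 0 1 0"
definition quat_k :: "'a::comm_ring_1 quat" where "quat_k = Quat 0 0 0 1"

definition qcnj :: "'a::comm_ring_1 quat \<Rightarrow> 'a quat" where
  "qcnj q = Quat (qRe q) (- qIm1 q) (- qIm2 q) (- qIm3 q)"

definition vectorial :: "'a::comm_ring_1 quat \<Rightarrow> bool" where
  "vectorial q \<longleftrightarrow> q + qcnj q = 0"

definition qvec :: "'a::comm_ring_1 quat \<Rightarrow> 'a ^ 3" where
  "qvec q = vector [qIm1 q, qIm2 q, qIm3 q]"

lemma quat_sel_simps [simp]:
  "qRe 0 = 0" "qIm1 0 = 0" "qIm2 0 = 0" "qIm3 0 = 0"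
  "qRe 1 = 1" "qIm1 1 = 0" "qIm2 1 = 0" "qIm3 1 = 0"
  "qRe (p + q) = qRe p + qRe q" "qIm1 (p + q) = qIm1 p + qIm1 q"
  "qIm2 (p + q) = qIm2 p + qIm2 q" "qIm3 (p + q) = qIm3 p + qIm3 q"
  "qRe (p - q) = qRe p - qRe q" "qIm1 (p - q) = qIm1 p - qIm1 q"
  "qIm2 (p - q) = qIm2 p - qIm2 q" "qIm3 (p - q) = qIm3 p - qIm3 q"
  "qRe (- p) = - qRe p" "qIm1 (- p) = - qIm1 p"
  "qIm2 (- p) = - qIm2 p" "qIm3 (- p) = - qIm3 p"
  "qRe (quat_of a) = a" "qIm1 (quat_of a) = 0" "qIm2 (quat_of a) = 0" "qIm3 (quat_of a) = 0"
  "qRe quat_i = 0" "qIm1 quat_i = 1" "qIm2 quat_i = 0" "qIm3 quat_i = 0"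
  "qRe (qcnj p) = qRe p" "qIm1 (qcnj p) = - qIm1 p"
  "qIm2 (qcnj p) = - qIm2 p" "qIm3 (qcnj p) = - qIm3 p"
  for p q :: "'a::comm_ring_1 quat"
  by (simp_all add: zero_quat_def one_quat_def plus_quat_def minus_quat_def uminus_quat_def
      quat_of_def quat_i_def qcnj_def)

lemma quat_sel_times:
  "qRe (p * q) = qRe p * qRe q - qIm1 p * qIm1 q - qIm2 p * qIm2 q - qIm3 p * qIm3 q"
  "qIm1 (p * q) = qRe p * qIm1 q + qIm1 p * qRe q + qIm2 p * qIm3 q - qIm3 p * qIm2 q"
  "qIm2 (p * q) = qRe p * qIm2 q - qIm1 p * qIm3 q + qIm2 p * qRe q + qIm3 p * qIm1 q"
  "qIm3 (p * q) = qRe p * qIm3 q + qIm1 p * qIm2 q - qIm2 p * qIm1 q + qIm3 p * qRe q"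
  by (simp_all add: times_quat_def)

lemma quat_units:
  "(quat_i :: 'a::comm_ring_1 quat) * quat_i = - 1" "(quat_j :: 'a quat) * quat_j = - 1"
  "(quat_k :: 'a quat) * quat_k = - 1"
  "(quat_i :: 'a quat) * quat_j = quat_k" "(quat_j :: 'a quat) * quat_i = - quat_k"
  "(quat_j :: 'a quat) * quat_k = quat_i" "(quat_k :: 'a quat) * quat_j = - quat_i"
  "(quat_k :: 'a quat) * quat_i = quat_j" "(quat_i :: 'a quat) * quat_k = - quat_j"
  by (simp_all add: quat_eq_iff times_quat_def quat_i_def quat_j_def quat_k_def
      one_quat_def uminus_quat_def)


section \<open>Quaternion polynomials\<close>

definition qcoeff :: "real poly quat \<Rightarrow> nat \<Rightarrow> real quat" where
  "qcoeff p n = Quat (coeff (qRe p) n) (coeff (qIm1 p) n) (coeff (qIm2 p) n) (coeff (qIm3 p) n)"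

definition qdegree :: "real poly quat \<Rightarrow> nat" where
  "qdegree p = (LEAST n. \<forall>m>n. qcoeff p m = 0)"

lemma qcoeff_inject: "p = q \<longleftrightarrow> (\<forall>n. qcoeff p n = qcoeff q n)"
  by (auto simp: quat_eq_iff qcoeff_def poly_eq_iff)

lemma sum_quat_sel:
  "qRe (sum f S) = (\<Sum>x\<in>S. qRe (f x))" "qIm1 (sum f S) = (\<Sum>x\<in>S. qIm1 (f x))"
  "qIm2 (sum f S) = (\<Sum>x\<in>S. qIm2 (f x))" "qIm3 (sum f S) = (\<Sum>x\<in>S. qIm3 (f x))"
  for f :: "'b \<Rightarrow> 'a::comm_ring_1 quat"
  by (induction S rule: infinite_finite_induct; simp)+

lemma qcoeff_mult: "qcoeff (p * q) n = (\<Sum>k\<le>n. qcoeff p k * qcoeff q (n - k))"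
  by (simp add: quat_eq_iff qcoeff_def quat_sel_times sum_quat_sel coeff_mult
      sum.distrib sum_subtractf)

lemma qdegree_eq_Max:
  "qdegree p = Max {degree (qRe p), degree (qIm1 p), degree (qIm2 p), degree (qIm3 p)}"
    (is "_ = Max ?D")
  unfolding qdegree_def
proof (rule Least_equality)
  show "\<forall>m>Max ?D. qcoeff p m = 0"
    by (auto simp: quat_eq_iff qcoeff_def coeff_eq_0)
next
  fix n assume "\<forall>m>n. qcoeff p m = 0"
  then show "Max ?D \<le> n"
    by (auto simp: quat_eq_iff qcoeff_def intro!: degree_le)
qed

definition subalgebra_1_i :: "real quat set" where
  "subalgebra_1_i = {quat_of x + quat_of y * quat_i | x y. True}"

definition reduced_wrt_i :: "real poly quat \<Rightarrow> bool" where
  "reduced_wrt_i A \<longleftrightarrow>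
     \<not> (\<exists>(c :: real poly) B. degree c > 0 \<and> A = quat_of c * B) \<and>
     \<not> (\<exists>B R. qdegree R > 0 \<and> (\<forall>n. qcoeff R n \<in> subalgebra_1_i) \<and> A = B * R)"

lemma reduced_wrt_i_nonzero: "reduced_wrt_i A \<Longrightarrow> A \<noteq> 0"
proof
  assume red: "reduced_wrt_i A" and "A = 0"
  then have "degree [:0, 1::real:] > 0" "A = quat_of [:0, 1:] * 0" by simp_all
  with red show False unfolding reduced_wrt_i_def by blast
qed

definition rotated_i :: "real poly quat \<Rightarrow> real poly quat" where
  "rotated_i A = A * quat_i * qcnj A"

lemma vectorial_rotated_i: "vectorial (rotated_i A)"
  by (simp add: vectorial_def rotated_i_def quat_eq_iff quat_sel_times algebra_simps)


section \<open>Rational curves\<close>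

text \<open>$\mathbb{R}(t)$ is \<open>real poly fract\<close>.\<close>

lemma quotient_rule_cong:
  fixes a b c d :: "real poly"
  assumes nz: "b \<noteq> 0" "d \<noteq> 0" and fr: "Fract a b = Fract c d"
  shows "Fract (pderiv a * b - a * pderiv b) (b * b) = Fract (pderiv c * d - c * pderiv d) (d * d)"
proof -
  have eq: "a * d = c * b" using fr nz by (simp add: eq_fract)
  have "pderiv (a * d) = pderiv (c * b)" using eq by simp
  then have eq': "d * pderiv a = c * pderiv b + b * pderiv c - a * pderiv d"
    by (simp add: pderiv_mult algebra_simps)
  have "(pderiv a * b - a * pderiv b) * (d * d)
      = (d * pderiv a) * (b * d) - (a * d) * (pderiv b * d)"
    by (simp add: algebra_simps)
  also have "\<dots> = (c * b) * (pderiv b * d) + b * pderiv c * (b * d) - (a * d) * (pderiv d * b)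
        - (a * d) * (pderiv b * d)"
    unfolding eq' by (simp add: algebra_simps)
  also have "\<dots> = (pderiv c * d - c * pderiv d) * (b * b)"
    unfolding eq by (simp add: algebra_simps)
  finally show ?thesis using nz by (simp add: eq_fract)
qed

text \<open>The quotient rule determines the derivative (\<open>fract_deriv_Fract\<close>).\<close>

definition fract_deriv :: "real poly fract \<Rightarrow> real poly fract" where
  "fract_deriv r = (THE s. \<exists>p q. q \<noteq> 0 \<and> r = Fract p q \<and>
     s = Fract (pderiv p * q - p * pderiv q) (q * q))"

lemma fract_deriv_Fract:
  "q \<noteq> 0 \<Longrightarrow> fract_deriv (Fract p q) = Fract (pderiv p * q - p * pderiv q) (q * q)"
  unfolding fract_deriv_def
proof (rule the_equality)
  assume "q \<noteq> 0"
  then show "\<exists>p' q'. q' \<noteq> 0 \<and> Fract p q = Fract p' q' \<and>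
      Fract (pderiv p * q - p * pderiv q) (q * q)
        = Fract (pderiv p' * q' - p' * pderiv q') (q' * q')"
    by (intro exI[of _ p] exI[of _ q]) simp
next
  fix s assume "q \<noteq> 0" "\<exists>p' q'. q' \<noteq> 0 \<and> Fract p q = Fract p' q' \<and>
      s = Fract (pderiv p' * q' - p' * pderiv q') (q' * q')"
  then obtain p' q' where "q' \<noteq> 0" "Fract p q = Fract p' q'"
      "s = Fract (pderiv p' * q' - p' * pderiv q') (q' * q')" by (elim exE conjE)
  with quotient_rule_cong[of q q' p p'] \<open>q \<noteq> 0\<close>
  show "s = Fract (pderiv p * q - p * pderiv q) (q * q)" by (simp only: simp_thms)
qed

definition curve_deriv :: "real poly fract ^ 3 \<Rightarrow> real poly fract ^ 3" where
  "curve_deriv r = (\<chi> j. fract_deriv (r $ j))"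

definition polynomial_curve :: "real poly fract ^ 3 \<Rightarrow> bool" where
  "polynomial_curve r \<longleftrightarrow> (\<forall>j. r $ j \<in> range to_fract)"

definition rational_PH_curve :: "real poly fract ^ 3 \<Rightarrow> bool" where
  "rational_PH_curve r \<longleftrightarrow> (\<exists>\<sigma>. (\<Sum>j\<in>UNIV. (curve_deriv r $ j)\<^sup>2) = \<sigma>\<^sup>2)"

text \<open>
  Linear dependence of a finite family (a list, so repeated vectors count as dependent, unlike
  for the set-based notion \<^const>\<open>vec.dependent\<close>).
\<close>

definition family_dependent :: "('a::field ^ 'n) list \<Rightarrow> bool" where
  "family_dependent vs \<longleftrightarrow>
     (\<exists>c. (\<exists>i<length vs. c i \<noteq> 0) \<and> (\<Sum>i<length vs. c i *s vs ! i) = 0)"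


section \<open>Motion polynomials\<close>

text \<open>\<open>Dual p d\<close> is $p + \varepsilon d$ with $\varepsilon$ central and $\varepsilon^2 = 0$.\<close>

datatype 'a dual = Dual (primal_part: 'a) (dual_part: 'a)

lemma dual_eq_iff: "x = y \<longleftrightarrow> primal_part x = primal_part y \<and> dual_part x = dual_part y"
  by (cases x; cases y) auto

instantiation dual :: (ring_1) ring_1
begin

definition zero_dual :: "'a dual" where "0 = Dual 0 0"

definition one_dual :: "'a dual" where "1 = Dual 1 0"

definition plus_dual :: "'a dual \<Rightarrow> 'a dual \<Rightarrow> 'a dual" where
  "x + y = Dual (primal_part x + primal_part y) (dual_part x + dual_part y)"

definition uminus_dual :: "'a dual \<Rightarrow> 'a dual" where
  "- x = Dual (- primal_part x) (- dual_part x)"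

definition minus_dual :: "'a dual \<Rightarrow> 'a dual \<Rightarrow> 'a dual" where
  "x - y = Dual (primal_part x - primal_part y) (dual_part x - dual_part y)"

definition times_dual :: "'a dual \<Rightarrow> 'a dual \<Rightarrow> 'a dual" where
  "x * y = Dual (primal_part x * primal_part y)
    (primal_part x * dual_part y + dual_part x * primal_part y)"

instance
  by standard
    (simp_all add: dual_eq_iff zero_dual_def one_dual_def plus_dual_def uminus_dual_def
      minus_dual_def times_dual_def algebra_simps)

end

definition motion_polynomial :: "real poly quat dual \<Rightarrow> bool" where
  "motion_polynomial C \<longleftrightarrow>
     primal_part C \<noteq> 0 \<and>
     primal_part C * qcnj (dual_part C) + dual_part C * qcnj (primal_part C) = 0"

text \<open>
  The numerator of the trajectory is vectorial and the denominator is a real polynomial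
  (\<open>qnorm_eq\<close>), so the trajectory is a vector over $\mathbb{R}(t)$.
\<close>

definition qnorm :: "'a::comm_ring_1 quat \<Rightarrow> 'a" where
  "qnorm p = qRe (p * qcnj p)"

lemma qnorm_eq: "p * qcnj p = quat_of (qnorm p)"
  by (simp add: qnorm_def quat_eq_iff quat_sel_times algebra_simps)

definition origin_trajectory :: "real poly quat dual \<Rightarrow> real poly fract ^ 3" where
  "origin_trajectory C =
     (let P = primal_part C; D = dual_part C
      in \<chi> j. to_fract (qvec (P * qcnj D - D * qcnj P) $ j) / to_fract (qnorm P))"

lemma vectorial_trajectory_numerator: "vectorial (P * qcnj D - D * qcnj P)"
  by (simp add: vectorial_def quat_eq_iff quat_sel_times algebra_simps)

text \<open>
  $(\alpha + \varepsilon \mathbf{b})\mathcal{A}$.  It satisfies the Study condition only if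
  $\mathbf{b}$ is vectorial (\<open>motion_polynomial_dual_scaled_iff\<close>).
\<close>

definition dual_scaled :: "real poly \<Rightarrow> real poly quat \<Rightarrow> real poly quat \<Rightarrow> real poly quat dual" where
  "dual_scaled \<alpha> b A = Dual (quat_of \<alpha>) b * Dual A 0"

definition framing_motion_polynomial ::
    "real poly \<Rightarrow> real poly quat \<Rightarrow> real poly quat \<Rightarrow> bool" where
  "framing_motion_polynomial \<alpha> b A \<longleftrightarrow>
     motion_polynomial (dual_scaled \<alpha> b A) \<and>
     family_dependent
       [curve_deriv (origin_trajectory (dual_scaled \<alpha> b A)),
        \<chi> j. to_fract (qvec (rotated_i A) $ j)]"

lemma qnorm_eq_0_iff: "qnorm p = 0 \<longleftrightarrow> p = 0" for p :: "real poly quat"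
proof
  assume "qnorm p = 0"
  then have e: "qRe p * qRe p + qIm1 p * qIm1 p + qIm2 p * qIm2 p + qIm3 p * qIm3 p = 0"
    by (simp add: qnorm_def quat_sel_times algebra_simps)
  have "poly (qRe p) x = 0 \<and> poly (qIm1 p) x = 0 \<and> poly (qIm2 p) x = 0 \<and> poly (qIm3 p) x = 0" for x
  proof -
    have "poly (qRe p * qRe p + qIm1 p * qIm1 p + qIm2 p * qIm2 p + qIm3 p * qIm3 p) x = 0"
      by (simp only: e poly_0)
    then have "(poly (qRe p) x)\<^sup>2 + (poly (qIm1 p) x)\<^sup>2 + (poly (qIm2 p) x)\<^sup>2 + (poly (qIm3 p) x)\<^sup>2 = 0"
      by (simp add: power2_eq_square)
    then show ?thesis
      by (simp add: add_nonneg_eq_0_iff)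
  qed
  then show "p = 0"
    by (auto simp: quat_eq_iff poly_eq_poly_eq_iff[symmetric] fun_eq_iff)
qed (simp add: qnorm_def)

lemma motion_polynomial_dual_scaled_iff:
  assumes "\<alpha> \<noteq> 0" "A \<noteq> 0"
  shows "motion_polynomial (dual_scaled \<alpha> b A) \<longleftrightarrow> vectorial b"
proof -
  let ?P = "quat_of \<alpha> * A" and ?D = "b * A"
  have "?P * qcnj ?D + ?D * qcnj ?P = quat_of (\<alpha> * qnorm A) * (b + qcnj b)"
    by (simp add: quat_eq_iff quat_sel_times qnorm_def algebra_simps)
  moreover have "quat_of (\<alpha> * qnorm A) * q = 0 \<longleftrightarrow> q = 0" for q
    using assms qnorm_eq_0_iff[of A] by (auto simp: quat_eq_iff quat_sel_times)
  moreover have "?P \<noteq> 0"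
    using assms by (auto simp: quat_eq_iff quat_sel_times)
  ultimately show ?thesis
    by (simp add: motion_polynomial_def dual_scaled_def times_dual_def vectorial_def)
qed

lemma origin_trajectory_dual_scaled:
  assumes "\<alpha> \<noteq> 0" "A \<noteq> 0"
  shows "origin_trajectory (dual_scaled \<alpha> b A) = (\<chi> j. - 2 * to_fract (qvec b $ j) / to_fract \<alpha>)"
proof -
  let ?P = "quat_of \<alpha> * A" and ?D = "b * A"
  have v: "qvec (?P * qcnj ?D - ?D * qcnj ?P) $ j = (- 2) * qvec b $ j * (\<alpha> * qnorm A)" for j
    using exhaust_3[of j]
    by (auto simp: qvec_def quat_sel_times qnorm_def algebra_simps)
  have n: "qnorm ?P = \<alpha> * (\<alpha> * qnorm A)"
    by (simp add: qnorm_def quat_sel_times algebra_simps)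
  have two: "to_fract (- 2 :: real poly) = - 2"
    by (metis one_add_one to_fract_1 to_fract_add to_fract_uminus)
  have "to_fract (qvec (?P * qcnj ?D - ?D * qcnj ?P) $ j) / to_fract (qnorm ?P)
      = - 2 * to_fract (qvec b $ j) / to_fract \<alpha>" for j
    using assms qnorm_eq_0_iff[of A] unfolding v n to_fract_mult two
    by (simp add: divide_simps)
  then show ?thesis
    by (simp add: origin_trajectory_def dual_scaled_def times_dual_def Let_def vec_eq_iff)
qed


section \<open>Taylor coefficients at a complex point\<close>

definition taylor_coeff :: "complex poly \<Rightarrow> complex \<Rightarrow> nat \<Rightarrow> complex" where
  "taylor_coeff p z i = coeff (pcompose p [:z, 1:]) i"

lemma taylor_coeff_expansion:
  "p = (\<Sum>i\<le>degree p. smult (taylor_coeff p z i) ([:- z, 1:] ^ i))"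
proof -
  have "poly p x = poly (\<Sum>i\<le>degree p. smult (taylor_coeff p z i) ([:- z, 1:] ^ i)) x" for x
  proof -
    have "poly p x = poly (pcompose p [:z, 1:]) (x - z)"
      by (simp add: poly_pcompose)
    also have "\<dots> = (\<Sum>i\<le>degree p. taylor_coeff p z i * (x - z) ^ i)"
      by (simp add: poly_altdef taylor_coeff_def degree_pcompose)
    finally show ?thesis
      by (simp add: poly_sum poly_power)
  qed
  then show ?thesis by (simp add: poly_eq_poly_eq_iff[symmetric] fun_eq_iff)
qed

lemma taylor_coeff_eq_0: "i > degree p \<Longrightarrow> taylor_coeff p z i = 0"
  by (simp add: taylor_coeff_def coeff_eq_0 degree_pcompose)

definition taylor_vector :: "real poly ^ 3 \<Rightarrow> complex \<Rightarrow> nat \<Rightarrow> complex ^ 3" where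
  "taylor_vector F z i = (\<chi> j. taylor_coeff (map_poly complex_of_real (F $ j)) z i)"

end

theory Submission
  imports Defs "HOL-Computational_Algebra.Polynomial_FPS"
    "HOL-Computational_Algebra.Fundamental_Theorem_Algebra"
begin

text \<open>
  Write \<open>F = A i A\<^sup>*\<close>.  Its Euclidean norm is the polynomial \<open>qnorm A\<close>, so every curve with
  \<open>r' = \<lambda> F\<close> is automatically a PH curve, and \<open>A\<close> being reduced forces \<open>F\<close> to have no complex zero.
  Condition 1 thus asks for a rational \<open>\<lambda>\<close> such that \<open>\<lambda> F\<close> is the derivative of a non-polynomial
  \<open>b / \<alpha>\<close>.  At a root \<open>z\<close> of \<open>\<alpha>\<close> of order \<open>n\<close> this means \<open>\<lambda> = p / (t - z)\<^bsup>n + 1\<^esup>\<close>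
  locally, and the only obstruction to integrating \<open>p F / (t - z)\<^bsup>n + 1\<^esup>\<close> is its residue,
  which is a linear relation between the Taylor coefficients \<open>f\<^sub>0, \<dots>, f\<^sub>n\<close> of \<open>F\<close>.
\<close>

section \<open>Real polynomials over the complex numbers\<close>

abbreviation cpoly :: "real poly \<Rightarrow> complex poly" where
  "cpoly \<equiv> map_poly complex_of_real"

lemma cpoly_add: "cpoly (p + q) = cpoly p + cpoly q"
  by (simp add: poly_eq_iff coeff_map_poly)

lemma cpoly_diff: "cpoly (p - q) = cpoly p - cpoly q"
  by (simp add: poly_eq_iff coeff_map_poly)

lemma cpoly_mult: "cpoly (p * q) = cpoly p * cpoly q"
  by (simp add: poly_eq_iff coeff_map_poly coeff_mult)

lemma cpoly_pderiv: "cpoly (pderiv p) = pderiv (cpoly p)"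
  by (simp add: poly_eq_iff coeff_map_poly coeff_pderiv)

lemma cpoly_eq_0_iff [simp]: "cpoly p = 0 \<longleftrightarrow> p = 0"
  by (simp add: poly_eq_iff coeff_map_poly)

lemma cpoly_Re_Im: "p = cpoly (map_poly Re p) + smult \<i> (cpoly (map_poly Im p))"
  by (simp add: poly_eq_iff coeff_map_poly complex_eq_iff)

lemma map_poly_Re_diff: "map_poly Re (p - q) = map_poly Re p - map_poly Re q"
  and map_poly_Im_diff: "map_poly Im (p - q) = map_poly Im p - map_poly Im q"
  by (simp_all add: poly_eq_iff coeff_map_poly)

text \<open>Taking coefficientwise real or imaginary parts is linear over \<open>real poly\<close>.
  A complex solution of a linear equation with real coefficients therefore splits into two real
  ones.\<close>

lemma map_poly_Re_cpoly_mult: "map_poly Re (cpoly p * q) = p * map_poly Re q"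
  and map_poly_Im_cpoly_mult: "map_poly Im (cpoly p * q) = p * map_poly Im q"
  by (simp_all add: poly_eq_iff coeff_map_poly coeff_mult)

lemma map_poly_Re_pderiv: "map_poly Re (pderiv p) = pderiv (map_poly Re p)"
  and map_poly_Im_pderiv: "map_poly Im (pderiv p) = pderiv (map_poly Im p)"
  by (simp_all add: poly_eq_iff coeff_map_poly coeff_pderiv del: of_nat_Suc)

lemma cnj_poly_cpoly: "cnj (poly (cpoly p) z) = poly (cpoly p) (cnj z)"
  by (rule poly_cnj_real) (simp add: coeff_map_poly)

text \<open>If a complex quotient exists, its real part is a real quotient.\<close>

lemma cpoly_dvd_iff: "cpoly p dvd cpoly q \<longleftrightarrow> p dvd q"
proof
  assume "cpoly p dvd cpoly q"
  then obtain r where "cpoly q = cpoly p * r" ..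
  then have "map_poly Re (cpoly q) = p * map_poly Re r"
    by (simp add: map_poly_Re_cpoly_mult)
  moreover have "map_poly Re (cpoly q) = q"
    by (simp add: poly_eq_iff coeff_map_poly)
  ultimately show "p dvd q" by simp
qed (auto simp: cpoly_mult)

text \<open>By the fundamental theorem of algebra \<open>p\<close> is a constant times its root
  powers; induction splits off one root with its full multiplicity at a time. The contrapositive
  locates a pole of \<open>q / p\<close>.\<close>

lemma poly_dvd_if_order_le:
  fixes p q :: "complex poly"
  assumes "p \<noteq> 0" and "\<And>z. poly p z = 0 \<Longrightarrow> [:- z, 1:] ^ order z p dvd q"
  shows "p dvd q"
  using assms
proof (induction p arbitrary: q rule: poly_root_order_induct)
  case (no_roots p)
  then have "degree p = 0"
    using fundamental_theorem_of_algebra[of p] constant_degree[of p] by blast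
  then obtain c where "p = [:c:]" by (rule degree_eq_zeroE)
  with no_roots show ?case by (simp add: const_poly_dvd_iff dvd_field_iff)
next
  case (root p z n)
  have "p \<noteq> 0" using root by auto
  have ord: "order z ([:- z, 1:] ^ n * p) = n"
    using root \<open>p \<noteq> 0\<close> by (simp add: order_mult order_power_n_n order_0I)
  have "[:- z, 1:] ^ n dvd q"
    using root.prems(2)[of z] root.hyps ord by (simp add: power_0_left)
  then obtain r where r: "q = [:- z, 1:] ^ n * r" ..
  \<comment> \<open>Splitting off the factor at \<open>z\<close> changes no multiplicity at another
    root \<open>x\<close>, neither in the divisor nor in \<open>q\<close>, so the hypothesis passes
    to \<open>p\<close> and \<open>r\<close>.\<close>
  have "p dvd r"
  proof (rule root.IH)
    fix x assume x: "poly p x = 0"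
    then have "x \<noteq> z" using root.hyps by auto
    have "order x ([:- z, 1:] ^ n * p) = order x p"
      using \<open>x \<noteq> z\<close> \<open>p \<noteq> 0\<close> by (simp add: order_mult order_0I)
    then have "[:- x, 1:] ^ order x p dvd [:- z, 1:] ^ n * r"
      using root.prems(2)[of x] x r by simp
    then have "r = 0 \<or> order x p \<le> order x ([:- z, 1:] ^ n * r)"
      by (auto simp: order_divides)
    moreover have "order x ([:- z, 1:] ^ n * r) = order x r" if "r \<noteq> 0"
      using \<open>x \<noteq> z\<close> that by (simp add: order_mult order_0I)
    ultimately show "[:- x, 1:] ^ order x p dvd r"
      by (cases "r = 0") (simp_all add: order_divides)
  qed (use \<open>p \<noteq> 0\<close> in simp)
  then show ?case using r by simp
qed simp

section \<open>The rotated direction of a reduced quaternion polynomial\<close>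

lemma Re_Im_mult_linear:
  fixes p :: "complex poly"
  shows "map_poly Re ([:- z, 1:] * p)
           = [:- Re z, 1:] * map_poly Re p + [:Im z:] * map_poly Im p"
    and "map_poly Im ([:- z, 1:] * p)
           = [:- Re z, 1:] * map_poly Im p - [:Im z:] * map_poly Re p"
  by (simp_all add: poly_eq_iff coeff_map_poly coeff_pCons split: nat.split)

text \<open>
  As \<open>Quat a b c d = (a + b i) + j (c - d i)\<close>, a common root \<open>z\<close> of \<open>a + b i\<close> and
  \<open>c - d i\<close>, read over the complex numbers, gives the right factor \<open>t - z\<close>.
\<close>

lemma common_root_imp_not_reduced:
  assumes "poly (cpoly (qRe A)) z + \<i> * poly (cpoly (qIm1 A)) z = 0"
    and "poly (cpoly (qIm2 A)) z - \<i> * poly (cpoly (qIm3 A)) z = 0"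
  shows "\<not> reduced_wrt_i A"
proof -
  define P Q where "P = cpoly (qRe A) + smult \<i> (cpoly (qIm1 A))"
    and "Q = cpoly (qIm2 A) - smult \<i> (cpoly (qIm3 A))"
  have "poly P z = 0" "poly Q z = 0" using assms by (simp_all add: P_def Q_def)
  then obtain P' Q' where P': "P = [:- z, 1:] * P'" and Q': "Q = [:- z, 1:] * Q'"
    by (metis poly_eq_0_iff_dvd dvdE)
  have A: "qRe A = map_poly Re P" "qIm1 A = map_poly Im P"
      "qIm2 A = map_poly Re Q" "qIm3 A = - map_poly Im Q"
    by (simp_all add: P_def Q_def poly_eq_iff coeff_map_poly)
  define B where "B = Quat (map_poly Re P') (map_poly Im P') (map_poly Re Q') (- map_poly Im Q')"
  \<comment> \<open>\<open>R\<close> is \<open>t - z\<close> with the complex unit read as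
    \<open>quat_i\<close>. Standing on the right, it multiplies both components of
    \<open>B = P' + j Q'\<close> at once; the minus sign in the last entry of \<open>B\<close> comes
    from \<open>j i = - k\<close>.\<close>
  define R where "R = Quat [:- Re z, 1:] [:- Im z:] 0 0"
  have "A = B * R"
    by (simp add: quat_eq_iff A P' Q' Re_Im_mult_linear quat_sel_times B_def R_def
        del: mult_pCons_left mult_pCons_right) (simp add: algebra_simps)
  moreover have "qdegree R > 0"
    by (simp add: qdegree_eq_Max R_def)
  moreover have "qcoeff R n \<in> subalgebra_1_i" for n
    unfolding subalgebra_1_i_def
    by (rule CollectI, rule exI[of _ "coeff (qRe R) n"], rule exI[of _ "coeff (qIm1 R) n"])
      (simp add: quat_eq_iff qcoeff_def quat_sel_times R_def)
  ultimately show ?thesis unfolding reduced_wrt_i_def by blast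
qed

lemma qvec_nth [simp]: "qvec q $ 1 = qIm1 q" "qvec q $ 2 = qIm2 q" "qvec q $ 3 = qIm3 q"
  by (simp_all add: qvec_def)

lemma qvec_rotated_i:
  "qvec (rotated_i A) $ 1 = qRe A * qRe A + qIm1 A * qIm1 A - qIm2 A * qIm2 A - qIm3 A * qIm3 A"
  "qvec (rotated_i A) $ 2 = 2 * (qIm1 A * qIm2 A + qRe A * qIm3 A)"
  "qvec (rotated_i A) $ 3 = 2 * (qIm1 A * qIm3 A - qRe A * qIm2 A)"
  by (simp_all add: rotated_i_def quat_sel_times algebra_simps)

text \<open>This is Lebesgue's three-square identity: conjugating the unit vector \<open>i\<close>
  by \<open>A\<close> scales its length by \<open>qnorm A\<close>.\<close>

lemma sum_squares_rotated_i: "(\<Sum>j\<in>UNIV. (qvec (rotated_i A) $ j)\<^sup>2) = (qnorm A)\<^sup>2"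
proof -
  have "(a * a + b * b - c * c - d * d)\<^sup>2 + (2 * (b * c + a * d))\<^sup>2 + (2 * (b * d - a * c))\<^sup>2
      = (a * a + b * b + c * c + d * d)\<^sup>2" for a b c d :: "real poly"
    by algebra
  then show ?thesis
    unfolding sum_3 qvec_rotated_i by (simp add: qnorm_def quat_sel_times)
qed

text \<open>The three forms are the components of \<open>rotated_i\<close>. By the three-square
  identity their common vanishing also annihilates \<open>a * a + b * b + c * c + d * d\<close>, so
  \<open>a * a + b * b\<close> and \<open>c * c + d * d\<close> vanish separately. Both split into
  linear factors over the complex numbers, and the last two forms decide which factors vanish
  together.\<close>

lemma complex_null_directions:
  fixes a b c d :: complex
  assumes 1: "a * a + b * b - c * c - d * d = 0" 
    and "2 * (b * c + a * d) = 0" and "2 * (b * d - a * c) = 0"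
  shows "(a + \<i> * b = 0 \<and> c - \<i> * d = 0) \<or> (a - \<i> * b = 0 \<and> c + \<i> * d = 0)"
proof -
  have 2: "b * c + a * d = 0" and 3: "b * d - a * c = 0"
    using assms(2,3) by (metis mult_eq_0_iff zero_neq_numeral)+
  have "(a * a + b * b + c * c + d * d) * (a * a + b * b + c * c + d * d)
      = (a * a + b * b - c * c - d * d) * (a * a + b * b - c * c - d * d)
        + 4 * ((b * c + a * d) * (b * c + a * d)) + 4 * ((b * d - a * c) * (b * d - a * c))"
    by algebra
  then have 4: "a * a + b * b + c * c + d * d = 0"
    unfolding 1 2 3 by simp
  have "2 * (a * a + b * b) = (a * a + b * b + c * c + d * d) + (a * a + b * b - c * c - d * d)"
    "2 * (c * c + d * d) = (a * a + b * b + c * c + d * d) - (a * a + b * b - c * c - d * d)"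
    by simp_all
  then have "2 * (a * a + b * b) = 0" "2 * (c * c + d * d) = 0"
    unfolding 1 4 by simp_all
  then have 5: "a * a + b * b = 0" "c * c + d * d = 0"
    by (metis mult_eq_0_iff zero_neq_numeral)+
  have "\<i> * \<i> = - 1" by simp
  then have "(a + \<i> * b) * (a - \<i> * b) = a * a + b * b"
    "(c + \<i> * d) * (c - \<i> * d) = c * c + d * d"
    "(a + \<i> * b) * (c + \<i> * d) = \<i> * (b * c + a * d) - (b * d - a * c)"
    "(a - \<i> * b) * (c - \<i> * d) = - \<i> * (b * c + a * d) - (b * d - a * c)"
    by algebra+
  then have "(a + \<i> * b) * (a - \<i> * b) = 0" "(c + \<i> * d) * (c - \<i> * d) = 0"
    "(a + \<i> * b) * (c + \<i> * d) = 0" "(a - \<i> * b) * (c - \<i> * d) = 0"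
    unfolding 2 3 5 by simp_all
  then show ?thesis unfolding mult_eq_0_iff by blast
qed

lemma rotated_i_no_complex_zero:
  assumes "reduced_wrt_i A"
  obtains j where "poly (cpoly (qvec (rotated_i A) $ j)) z \<noteq> 0"
proof (rule ccontr)
  assume "\<not> thesis"
  then have 0: "poly (cpoly (qvec (rotated_i A) $ j)) z = 0" for j using that by blast
  define a b c d where "a = poly (cpoly (qRe A)) z" and "b = poly (cpoly (qIm1 A)) z"
    and "c = poly (cpoly (qIm2 A)) z" and "d = poly (cpoly (qIm3 A)) z"
  note abcd = a_def b_def c_def d_def
  have two: "cpoly 2 = 2"
    by (simp add: numeral_poly map_poly_pCons)
  have "(a + \<i> * b = 0 \<and> c - \<i> * d = 0) \<or> (a - \<i> * b = 0 \<and> c + \<i> * d = 0)"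
    using 0[of 1] 0[of 2] 0[of 3]
    unfolding qvec_rotated_i cpoly_mult cpoly_add cpoly_diff two
    by (intro complex_null_directions) (simp_all add: abcd)
  then show False
  proof
    assume "a + \<i> * b = 0 \<and> c - \<i> * d = 0"
    with common_root_imp_not_reduced[of A z] assms show False by (simp add: abcd)
  next
    assume "a - \<i> * b = 0 \<and> c + \<i> * d = 0"
    \<comment> \<open>The components of \<open>A\<close> have real coefficients, so conjugation
      turns the second alternative at \<open>z\<close> into the first one at
      \<open>cnj z\<close>.\<close>
    then have "cnj (a - \<i> * b) = 0" "cnj (c + \<i> * d) = 0" by simp_all
    with common_root_imp_not_reduced[of A "cnj z"] assms show False
      by (simp add: abcd cnj_poly_cpoly)
  qed
qed

section \<open>Linear relations and derivatives of rational functions\<close>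

lemma family_dependent_iff:
  "family_dependent (map f [0..<Suc n]) \<longleftrightarrow>
     (\<exists>c. (\<exists>i\<le>n. c i \<noteq> 0) \<and> (\<forall>j. (\<Sum>i\<le>n. c i * f i $ j) = 0))"
proof -
  have "(\<Sum>i<Suc n. c i *s map f [0..<Suc n] ! i) $ j = (\<Sum>i\<le>n. c i * f i $ j)" for c j
    unfolding lessThan_Suc_atMost by (auto intro!: sum.cong simp: nth_append simp del: upt_Suc)
  then show ?thesis
    by (simp add: family_dependent_def vec_eq_iff less_Suc_eq_le del: upt_Suc)
qed

text \<open>For distinct vectors this is the dimension bound for sets; a repeated vector gives a
  relation with coefficients \<open>1\<close> and \<open>-1\<close>.\<close>

lemma family_dependent_if_length_gt:
  fixes vs :: "('a::field ^ 'n) list"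
  assumes "length vs > CARD('n)"
  shows "family_dependent vs"
proof (cases "distinct vs")
  case True
  then have "vec.dependent (set vs)"
    using assms vec.dim_subset_UNIV[of "set vs"]
    by (intro vec.dependent_biggerset_general) (simp add: distinct_card vec.dimension_def card_cart_basis)
  then obtain u where u: "\<exists>v\<in>set vs. u v \<noteq> 0" "(\<Sum>v\<in>set vs. u v *s v) = 0"
    by (auto simp: vec.dependent_finite)
  have "(\<Sum>i<length vs. u (vs ! i) *s vs ! i) = (\<Sum>v\<in>set vs. u v *s v)"
    by (rule sum.reindex_bij_betw[OF bij_betw_nth]) (use True in auto)
  then show ?thesis
    using u unfolding family_dependent_def
    by (intro exI[of _ "\<lambda>i. u (vs ! i)"]) (auto simp: in_set_conv_nth)
next
  case False
  then obtain i j where ij: "i < length vs" "j < length vs" "i \<noteq> j" "vs ! i = vs ! j"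
    by (auto simp: distinct_conv_nth)
  define c where "c k = (if k = i then 1 else if k = j then -1 else (0::'a))" for k
  have "(\<Sum>k<length vs. c k *s vs ! k) = (\<Sum>k\<in>{i, j}. c k *s vs ! k)"
    by (rule sum.mono_neutral_right) (use ij in \<open>auto simp: c_def\<close>)
  also have "\<dots> = 0" using ij by (simp add: c_def)
  finally show ?thesis
    unfolding family_dependent_def using ij by (intro exI[of _ c]) (auto simp: c_def)
qed

text \<open>
  The hypothesis says \<open>(b / a)' = w F / (u a\<^sup>2)\<close>; the relation is the vanishing of the residue of
  this derivative.
\<close>

lemma relation_of_fps_derivative:
  fixes a u w :: "'a::field_char_0 fps" and b F :: "'j \<Rightarrow> 'a fps"
  assumes a: "a = fps_X ^ Suc m * e" and e: "fps_nth e 0 \<noteq> 0" and u: "u \<noteq> 0"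
    and deriv: "\<And>j. u * (a * fps_deriv (b j) - b j * fps_deriv a) = w * F j"
    and F: "fps_nth (F j0) 0 \<noteq> 0" and b: "\<not> fps_X ^ Suc m dvd b j1"
  obtains c where "\<exists>i\<le>Suc m. c i \<noteq> 0" and "\<And>j. (\<Sum>i\<le>Suc m. c i * fps_nth (F j) i) = 0"
proof -
  let ?n = "of_nat (Suc m) :: 'a fps"
  \<comment> \<open>Dividing out the local unit \<open>e\<close> gives
    \<open>b / a = B / X^n\<close> with \<open>n = Suc m\<close>, whose derivative is
    \<open>(X B' - n B) / X^(n+1)\<close>; \<open>vB\<close> is the hypothesis in this form.\<close>
  define B where "B j = b j * inverse e" for j
  have bB: "b j = e * B j" for j
    using inverse_mult_eq_1[OF e] by (simp add: B_def ac_simps)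
  define v where "v = u * (fps_X ^ m * (e * e))"
  have "e \<noteq> 0" using e by auto
  then have v: "v \<noteq> 0" using u by (simp add: v_def)
  have vB: "v * (fps_X * fps_deriv (B j) - ?n * B j) = w * F j" for j
  proof -
    have da: "fps_deriv a = ?n * (fps_X ^ m * e) + fps_X * (fps_X ^ m * fps_deriv e)"
      unfolding a fps_deriv_mult fps_deriv_power' by (simp add: algebra_simps del: of_nat_Suc)
    show ?thesis
      unfolding deriv[symmetric] da unfolding bB a v_def by (simp add: algebra_simps)
  qed
  \<comment> \<open>Some component of \<open>F\<close> does not vanish at the point and is thus a
    unit, so the pole of \<open>\<lambda> = w / (u a^2)\<close> has order at most
    \<open>n + 1\<close>; the quotient \<open>p\<close> below satisfies
    \<open>\<lambda> = p / X^(n+1)\<close>.\<close>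
  have "v dvd w"
  proof -
    have "v dvd w * F j0" using vB[of j0] by (metis dvd_triv_left)
    moreover have "is_unit (F j0)" using F by simp
    ultimately show ?thesis by (simp add: dvd_mult_unit_iff)
  qed
  then obtain p where p: "w = v * p" ..
  have eq: "fps_X * fps_deriv (B j) - ?n * B j = p * F j" for j
    using vB[of j] v by (simp add: p)
  \<comment> \<open>At \<open>k = Suc m\<close> the left side is zero, which is the residue
    condition; at smaller \<open>k\<close> the coefficient of \<open>B j\<close> is determined by
    \<open>p * F j\<close>.\<close>
  have coeff: "(of_nat k - of_nat (Suc m)) * fps_nth (B j) k = fps_nth (p * F j) k" for j k
    unfolding eq[symmetric] by (cases k) (simp_all add: fps_of_nat[symmetric] algebra_simps del: of_nat_Suc)
  show thesis
  proof (rule that)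
    show "(\<Sum>i\<le>Suc m. fps_nth p (Suc m - i) * fps_nth (F j) i) = 0" for j
    proof -
      have "(\<Sum>i\<le>Suc m. fps_nth p (Suc m - i) * fps_nth (F j) i) = fps_nth (F j * p) (Suc m)"
        by (simp only: fps_mult_nth atLeast0AtMost mult.commute[of "fps_nth p _"])
      also have "\<dots> = 0" using coeff[of "Suc m" j] by (simp only: mult.commute) simp
      finally show ?thesis .
    qed
    \<comment> \<open>A trivial relation would kill all coefficients of \<open>B j1\<close> below
      \<open>Suc m\<close>, so \<open>b j1 / a\<close> would have no pole.\<close>
    show "\<exists>i\<le>Suc m. fps_nth p (Suc m - i) \<noteq> 0"
    proof (rule ccontr)
      assume "\<not> ?thesis"
      then have "fps_nth p (Suc m - (Suc m - k)) = 0" if "k \<le> Suc m" for k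
        by (metis diff_le_self)
      then have p0: "fps_nth p k = 0" if "k \<le> Suc m" for k using that by simp
      have "fps_nth (B j1) k = 0" if "k < Suc m" for k
      proof -
        have "fps_nth (p * F j1) k = 0"
          unfolding fps_mult_nth using that by (intro sum.neutral) (simp add: p0)
        then have "(of_nat k - of_nat (Suc m)) * fps_nth (B j1) k = 0" by (simp only: coeff)
        moreover have "(of_nat k :: 'a) \<noteq> of_nat (Suc m)" using that by (simp only: of_nat_eq_iff)
        ultimately show ?thesis by (simp del: of_nat_Suc)
      qed
      then have "fps_X ^ Suc m dvd B j1"
        by (cases "B j1 = 0") (auto simp: fps_dvd_iff fps_X_power_subdegree simp del: power_Suc
            intro!: subdegree_geI)
      then show False using b by (simp add: bB del: power_Suc)
    qed
  qed
qed

text \<open>The operator \<open>t d/dt - n\<close> is diagonal on monomials with eigenvalues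
  \<open>k - n\<close>, so only the coefficient at \<open>n\<close> obstructs solving the
  equation.\<close>

lemma exists_poly_euler_derivative:
  fixes p :: "'a::field_char_0 poly"
  assumes "coeff p n = 0"
  obtains B where "[:0, 1:] * pderiv B - of_nat n * B = p"
proof
  \<comment> \<open>For \<open>k = n\<close> the quotient is a division by zero with value 0, which
    is harmless since \<open>coeff p n = 0\<close>.\<close>
  define B where "B = (\<Sum>k\<le>degree p. monom (coeff p k / (of_nat k - of_nat n)) k)"
  have B: "coeff B k = coeff p k / (of_nat k - of_nat n)" for k
    by (simp add: B_def coeff_sum coeff_eq_0)
  have "coeff ([:0, 1:] * pderiv B - of_nat n * B) k = (of_nat k - of_nat n) * coeff B k" for k
    by (cases k) (simp_all add: coeff_pderiv of_nat_poly algebra_simps del: of_nat_Suc)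
  then show "[:0, 1:] * pderiv B - of_nat n * B = p"
    using assms by (auto simp: poly_eq_iff B)
qed

lemma pderiv_X_power_mult:
  fixes p :: "'a::field_char_0 poly"
  shows "pderiv ([:0, 1:] ^ Suc m * p)
    = of_nat (Suc m) * ([:0, 1:] ^ m * p) + [:0, 1:] * ([:0, 1:] ^ m * pderiv p)"
proof -
  have smult: "smult (of_nat (Suc m)) q = of_nat (Suc m) * q" for q :: "'a poly"
    by (simp add: of_nat_poly del: of_nat_Suc)
  have "pderiv [:0, 1::'a:] = 1" by (simp add: pderiv_pCons)
  then show ?thesis
    unfolding pderiv_mult pderiv_power_Suc smult
    by (simp add: algebra_simps del: of_nat_Suc mult_pCons_left mult_pCons_right)
qed

text \<open>Converse of \<open>relation_of_fps_derivative\<close> for a root at the origin. A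
  relation yields \<open>p\<close> such that \<open>p F / X^(n+1)\<close> with
  \<open>n = Suc m\<close> has residue zero and integrates to some \<open>B / X^n\<close>. With
  \<open>b = e B\<close> one has \<open>b / a = B / X^n\<close>, so the other roots of
  \<open>a\<close> contribute no poles.\<close>

lemma poly_derivative_of_relation:
  fixes a :: "'a::field_char_0 poly" and F :: "'j \<Rightarrow> 'a poly"
  assumes a: "a = [:0, 1:] ^ Suc m * e" and e: "e \<noteq> 0" and F: "coeff (F j0) 0 \<noteq> 0"
    and c: "\<exists>i\<le>Suc m. c i \<noteq> 0" "\<And>j. (\<Sum>i\<le>Suc m. c i * coeff (F j) i) = 0"
  obtains b w j1 where "\<And>j. a * pderiv (b j) - b j * pderiv a = w * F j" and "\<not> a dvd b j1"
proof -
  let ?X = "[:0, 1::'a:]" and ?n = "of_nat (Suc m) :: 'a poly"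
  \<comment> \<open>The coefficients are reversed so that the relation becomes the vanishing of
    coefficient \<open>Suc m\<close> of \<open>p * F j\<close>.\<close>
  define p where "p = (\<Sum>i\<le>Suc m. monom (c (Suc m - i)) i)"
  have p: "coeff p i = (if i \<le> Suc m then c (Suc m - i) else 0)" for i
    by (simp add: p_def coeff_sum del: sum.atMost_Suc)
  have "coeff (p * F j) (Suc m) = 0" for j
  proof -
    have "coeff (F j * p) (Suc m) = (\<Sum>i\<le>Suc m. c i * coeff (F j) i)"
      unfolding coeff_mult by (rule sum.cong) (auto simp: p)
    then show ?thesis by (simp only: c mult.commute)
  qed
  then have "\<exists>B. ?X * pderiv B - ?n * B = p * F j" for j
    by (metis exists_poly_euler_derivative)
  then obtain B where B: "\<And>j. ?X * pderiv (B j) - ?n * B j = p * F j" by metis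
  have "p \<noteq> 0"
  proof
    assume "p = 0"
    then have "c (Suc m - (Suc m - i)) = 0" if "i \<le> Suc m" for i
      using p[of "Suc m - i"] that by simp
    with c(1) show False by auto
  qed
  have "degree p \<le> Suc m" by (rule degree_le) (simp add: p)
  show thesis
  proof (rule that)
    show "a * pderiv (e * B j) - e * B j * pderiv a = (?X ^ m * (e * e) * p) * F j" for j
    proof -
      have da: "pderiv a = ?n * (?X ^ m * e) + ?X * (?X ^ m * pderiv e)"
        unfolding a by (rule pderiv_X_power_mult)
      have "(?X ^ m * (e * e) * p) * F j = ?X ^ m * (e * e) * (?X * pderiv (B j) - ?n * B j)"
        unfolding B by (simp only: mult.assoc)
      also have "\<dots> = a * pderiv (e * B j) - e * B j * pderiv a"
        unfolding da unfolding a pderiv_mult power_Suc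
        by (simp add: algebra_simps del: mult_pCons_left mult_pCons_right)
      finally show ?thesis ..
    qed
    \<comment> \<open>If \<open>B j0 / X^n\<close> were a polynomial \<open>G\<close>, then
      \<open>p * F j0 = X^(n+1) * G'\<close> would vanish at 0 to order at least
      \<open>n + 1\<close>; but \<open>F j0\<close> does not vanish there and
      \<open>degree p\<close> is at most \<open>n\<close>.\<close>
    show "\<not> a dvd e * B j0"
    proof
      assume "a dvd e * B j0"
      then have "?X ^ Suc m dvd B j0"
        using e unfolding a by (metis dvd_mult_cancel_left mult.commute)
      then obtain G where G: "B j0 = ?X ^ Suc m * G" ..
      have "p * F j0 = ?X ^ Suc (Suc m) * pderiv G"
        unfolding B[symmetric] G pderiv_X_power_mult unfolding power_Suc
        by (simp add: algebra_simps del: of_nat_Suc mult_pCons_left mult_pCons_right)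
      then have "[:- 0, 1:] ^ Suc (Suc m) dvd p * F j0"
        by (simp only: minus_zero dvd_triv_left)
      moreover have "F j0 \<noteq> 0" using F by auto
      ultimately have "Suc (Suc m) \<le> order 0 (p * F j0)"
        using \<open>p \<noteq> 0\<close> by (simp only: order_divides) simp
      also have "\<dots> = order 0 p"
        using \<open>p \<noteq> 0\<close> \<open>F j0 \<noteq> 0\<close> F by (simp add: order_mult order_0I poly_0_coeff_0)
      also have "\<dots> \<le> Suc m"
        using order_degree[OF \<open>p \<noteq> 0\<close>, of 0] \<open>degree p \<le> Suc m\<close> by simp
      finally show False by simp
    qed
  qed
qed

section \<open>Framing motion polynomials\<close>

lemma curve_deriv_trajectory:
  assumes "\<alpha> \<noteq> 0" "A \<noteq> 0"
  shows "curve_deriv (origin_trajectory (dual_scaled \<alpha> b A)) $ j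
    = to_fract (- 2 * (\<alpha> * pderiv (qvec b $ j) - qvec b $ j * pderiv \<alpha>)) / to_fract (\<alpha> * \<alpha>)"
proof -
  have two: "to_fract (- 2 :: real poly) = - 2"
    by (metis one_add_one to_fract_1 to_fract_add to_fract_uminus)
  have "- 2 * to_fract (qvec b $ j) / to_fract \<alpha> = Fract (- 2 * qvec b $ j) \<alpha>"
    by (simp only: Fract_conv_to_fract to_fract_mult two)
  then have "curve_deriv (origin_trajectory (dual_scaled \<alpha> b A)) $ j
    = Fract (pderiv (- 2 * qvec b $ j) * \<alpha> - (- 2 * qvec b $ j) * pderiv \<alpha>) (\<alpha> * \<alpha>)"
    using assms by (simp only: curve_deriv_def origin_trajectory_dual_scaled vec_lambda_beta
        fract_deriv_Fract not_False_eq_True)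
  also have "pderiv (- 2 * qvec b $ j) * \<alpha> - (- 2 * qvec b $ j) * pderiv \<alpha>
    = - 2 * (\<alpha> * pderiv (qvec b $ j) - qvec b $ j * pderiv \<alpha>)"
  proof -
    have "pderiv (- 2 * qvec b $ j) = - 2 * pderiv (qvec b $ j)"
      by (simp add: pderiv_mult pderiv_minus)
    then show ?thesis by (simp add: algebra_simps)
  qed
  finally show ?thesis by (simp only: Fract_conv_to_fract)
qed

lemma polynomial_curve_trajectory_iff:
  assumes "\<alpha> \<noteq> 0" "A \<noteq> 0"
  shows "polynomial_curve (origin_trajectory (dual_scaled \<alpha> b A)) \<longleftrightarrow> (\<forall>j. \<alpha> dvd qvec b $ j)"
proof -
  have two: "to_fract (- 2 :: real poly) = - 2"
    by (metis one_add_one to_fract_1 to_fract_add to_fract_uminus)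
  have "- 2 * to_fract p / to_fract \<alpha> \<in> range to_fract \<longleftrightarrow> \<alpha> dvd p" for p
  proof -
    have "- 2 * to_fract p / to_fract \<alpha> = to_fract q \<longleftrightarrow> - 2 * p = \<alpha> * q" for q
    proof -
      have "- 2 * to_fract p / to_fract \<alpha> = to_fract q \<longleftrightarrow> to_fract (- 2 * p) = to_fract (\<alpha> * q)"
        using assms(1) unfolding to_fract_mult two by (simp add: field_simps)
      then show ?thesis by (simp only: to_fract_eq_iff)
    qed
    then have "- 2 * to_fract p / to_fract \<alpha> \<in> range to_fract \<longleftrightarrow> \<alpha> dvd - 2 * p"
      by (auto simp: image_iff dvd_def)
    also have "- 2 * p = smult (- 2) p"
      by (simp add: numeral_poly)
    also have "\<alpha> dvd smult (- 2) p \<longleftrightarrow> \<alpha> dvd p"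
      by (simp add: dvd_smult_iff)
    finally show ?thesis .
  qed
  then show ?thesis
    using assms by (simp only: polynomial_curve_def origin_trajectory_dual_scaled vec_lambda_beta
        not_False_eq_True)
qed

lemma family_dependent_pair_iff:
  fixes x y :: "'a::field ^ 'n"
  assumes "y \<noteq> 0"
  shows "family_dependent [x, y] \<longleftrightarrow> (\<exists>k. x = k *s y)"
proof
  assume "family_dependent [x, y]"
  then obtain c where c: "\<exists>i<2::nat. c i \<noteq> 0" "c 0 *s x + c 1 *s y = 0"
    by (auto simp: family_dependent_def numeral_2_eq_2)
  have "c 0 \<noteq> 0"
  proof
    assume "c 0 = 0"
    with c assms have "c 1 = 0" by simp
    with \<open>c 0 = 0\<close> c(1) show False by (auto simp: less_2_cases_iff)
  qed
  then have "x = (- c 1 / c 0) *s y"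
    using c(2) by (auto simp: vec_eq_iff field_simps add_eq_0_iff2)
  then show "\<exists>k. x = k *s y" ..
next
  assume "\<exists>k. x = k *s y"
  then obtain k where "x = k *s y" ..
  then show "family_dependent [x, y]"
    unfolding family_dependent_def
    by (intro exI[of _ "\<lambda>i. if i = 0 then 1 else - k"]) (auto simp: vec_eq_iff)
qed

text \<open>The factor of proportionality in the field of rational functions is written as a
  fraction; its denominator and the factors \<open>-2\<close> and \<open>\<alpha>^2\<close> from
  differentiating \<open>-2 b / \<alpha>\<close> are absorbed into \<open>u\<close> and
  \<open>w\<close>.\<close>

lemma framing_iff:
  assumes "\<alpha> \<noteq> 0" "A \<noteq> 0" and F: "qvec (rotated_i A) \<noteq> 0"
  shows "framing_motion_polynomial \<alpha> b A \<longleftrightarrow> vectorial b \<and>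
    (\<exists>u w. u \<noteq> 0 \<and> (\<forall>j. u * (\<alpha> * pderiv (qvec b $ j) - qvec b $ j * pderiv \<alpha>)
       = w * qvec (rotated_i A) $ j))"
proof -
  let ?F = "\<chi> j. to_fract (qvec (rotated_i A) $ j)"
  let ?D = "\<lambda>j. \<alpha> * pderiv (qvec b $ j) - qvec b $ j * pderiv \<alpha>"
  let ?r = "curve_deriv (origin_trajectory (dual_scaled \<alpha> b A))"
  have "?F \<noteq> 0" using F by (simp add: vec_eq_iff)
  have key: "?r = Fract w u *s ?F \<longleftrightarrow> (\<forall>j. (- 2 * u) * ?D j = (w * (\<alpha> * \<alpha>)) * qvec (rotated_i A) $ j)"
    if "u \<noteq> 0" for u w
  proof -
    have "to_fract (- 2 * ?D j) / to_fract (\<alpha> * \<alpha>)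
        = to_fract w / to_fract u * to_fract (qvec (rotated_i A) $ j)
      \<longleftrightarrow> to_fract ((- 2 * u) * ?D j) = to_fract ((w * (\<alpha> * \<alpha>)) * qvec (rotated_i A) $ j)" for j
      using assms(1) that unfolding to_fract_mult by (simp add: divide_simps mult_ac)
    then show ?thesis
      unfolding vec_eq_iff curve_deriv_trajectory[OF assms(1,2)]
      by (simp only: vector_smult_component vec_lambda_beta Fract_conv_to_fract to_fract_eq_iff)
  qed
  have "(\<exists>k. ?r = k *s ?F) \<longleftrightarrow> (\<exists>u w. u \<noteq> 0 \<and> (\<forall>j. u * ?D j = w * qvec (rotated_i A) $ j))"
  proof
    assume "\<exists>k. ?r = k *s ?F"
    then obtain k where k: "?r = k *s ?F" ..
    obtain w u where "k = Fract w u" "u \<noteq> 0" by (cases k) auto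
    with k key show "\<exists>u w. u \<noteq> 0 \<and> (\<forall>j. u * ?D j = w * qvec (rotated_i A) $ j)"
      by (intro exI[of _ "- 2 * u"] exI[of _ "w * (\<alpha> * \<alpha>)"]) simp
  next
    assume "\<exists>u w. u \<noteq> 0 \<and> (\<forall>j. u * ?D j = w * qvec (rotated_i A) $ j)"
    then obtain u w where uw: "u \<noteq> 0" "\<And>j. u * ?D j = w * qvec (rotated_i A) $ j" by blast
    have "(- 2 * (u * (\<alpha> * \<alpha>))) * ?D j = ((- 2 * w) * (\<alpha> * \<alpha>)) * qvec (rotated_i A) $ j" for j
    proof -
      have "(- 2 * (u * (\<alpha> * \<alpha>))) * ?D j = - 2 * (\<alpha> * \<alpha>) * (u * ?D j)"
        by (simp only: mult_ac)
      also have "\<dots> = ((- 2 * w) * (\<alpha> * \<alpha>)) * qvec (rotated_i A) $ j"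
        unfolding uw by (simp only: mult_ac)
      finally show ?thesis .
    qed
    moreover have "u * (\<alpha> * \<alpha>) \<noteq> 0" using uw assms by simp
    ultimately have "?r = Fract (- 2 * w) (u * (\<alpha> * \<alpha>)) *s ?F"
      using key by blast
    then show "\<exists>k. ?r = k *s ?F" ..
  qed
  then show ?thesis
    unfolding framing_motion_polynomial_def motion_polynomial_dual_scaled_iff[OF assms(1,2)]
      family_dependent_pair_iff[OF \<open>?F \<noteq> 0\<close>] by blast
qed

text \<open>The derivative is \<open>k\<close> times \<open>rotated_i A\<close>, so
  \<open>k * qnorm A\<close> serves as the speed.\<close>

lemma framing_imp_PH:
  assumes "framing_motion_polynomial \<alpha> b A" and F: "qvec (rotated_i A) \<noteq> 0"
  shows "rational_PH_curve (origin_trajectory (dual_scaled \<alpha> b A))"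
proof -
  let ?F = "\<chi> j. to_fract (qvec (rotated_i A) $ j)"
  have "?F \<noteq> 0" using F by (simp add: vec_eq_iff)
  then obtain k where k: "curve_deriv (origin_trajectory (dual_scaled \<alpha> b A)) = k *s ?F"
    using assms(1) family_dependent_pair_iff by (auto simp: framing_motion_polynomial_def)
  have "(\<Sum>j\<in>UNIV. (curve_deriv (origin_trajectory (dual_scaled \<alpha> b A)) $ j)\<^sup>2)
      = k\<^sup>2 * to_fract (\<Sum>j\<in>UNIV. (qvec (rotated_i A) $ j)\<^sup>2)"
    unfolding k by (simp add: power2_eq_square sum_distrib_left algebra_simps)
  also have "\<dots> = (k * to_fract (qnorm A))\<^sup>2"
    unfolding sum_squares_rotated_i by (simp add: power2_eq_square)
  finally show ?thesis unfolding rational_PH_curve_def ..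
qed

section \<open>Framing motions and relations at a root\<close>

text \<open>The substitution \<open>t -> t + z\<close> moves \<open>z\<close> to the origin, where
  multiplicities become powers of \<open>t\<close> and Taylor coefficients become ordinary
  coefficients.\<close>

abbreviation recenter :: "'a::comm_ring_1 \<Rightarrow> 'a poly \<Rightarrow> 'a poly" where
  "recenter z p \<equiv> pcompose p [:z, 1:]"

lemma pderiv_recenter: "pderiv (recenter z p) = recenter z (pderiv p)"
  for z :: "'a::{comm_ring_1, semiring_no_zero_divisors}"
  by (simp add: pderiv_pcompose pderiv_pCons)

lemma recenter_uminus_recenter [simp]: "recenter (- z) (recenter z p) = p"
  by (simp add: pcompose_assoc[symmetric] pcompose_pCons)

lemma recenter_power_linear: "recenter z ([:- z, 1:] ^ n) = [:0, 1:] ^ n"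
proof (induction n)
  case (Suc n)
  have "recenter z [:- z, 1:] = [:0, 1:]" by (simp add: pcompose_pCons)
  then show ?case by (simp only: power_Suc pcompose_mult Suc)
qed (simp add: pcompose_1)

lemma recenter_dvd_iff: "recenter z p dvd recenter z q \<longleftrightarrow> p dvd q"
proof
  assume "recenter z p dvd recenter z q"
  then obtain r where "recenter z q = recenter z p * r" ..
  then have "recenter (- z) (recenter z q) = recenter (- z) (recenter z p * r)" by simp
  then show "p dvd q" by (simp add: pcompose_mult)
qed (auto simp: pcompose_mult)

lemma taylor_vector_nth:
  "taylor_vector F z i $ j = coeff (recenter z (cpoly (F $ j))) i"
  by (simp add: taylor_vector_def taylor_coeff_def)

lemma recenter_root_decomp:
  fixes p :: "complex poly"
  assumes "p \<noteq> 0" "order z p = Suc m"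
  obtains e where "recenter z p = [:0, 1:] ^ Suc m * e" "coeff e 0 \<noteq> 0"
proof -
  obtain q where q: "p = [:- z, 1:] ^ Suc m * q" "\<not> [:- z, 1:] dvd q"
    using order_decomp[OF assms(1), of z] assms(2) by metis
  show thesis
  proof (rule that)
    show "recenter z p = [:0, 1:] ^ Suc m * recenter z q"
      unfolding q(1) pcompose_mult recenter_power_linear ..
    show "coeff (recenter z q) 0 \<noteq> 0"
      using q(2) by (simp add: poly_eq_0_iff_dvd)
  qed
qed

lemma framing_imp_relation:
  fixes b F :: "real poly ^ 3"
  assumes "\<alpha> \<noteq> 0" "u \<noteq> 0"
    and deriv: "\<And>j. u * (\<alpha> * pderiv (b $ j) - b $ j * pderiv \<alpha>) = w * F $ j"
    and F: "\<And>z. \<exists>j. poly (cpoly (F $ j)) z \<noteq> 0"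
    and b: "\<not> \<alpha> dvd b $ j1"
  obtains z where "poly (cpoly \<alpha>) z = 0"
    "family_dependent (map (taylor_vector F z) [0..<Suc (order z (cpoly \<alpha>))])"
proof -
  have "\<not> cpoly \<alpha> dvd cpoly (b $ j1)" using b by (simp add: cpoly_dvd_iff)
  \<comment> \<open>The component \<open>j1\<close> of \<open>b / \<alpha>\<close> is not a
    polynomial and so has a pole at some root \<open>z\<close>.\<close>
  then obtain z where z: "poly (cpoly \<alpha>) z = 0" "\<not> [:- z, 1:] ^ order z (cpoly \<alpha>) dvd cpoly (b $ j1)"
    using poly_dvd_if_order_le[of "cpoly \<alpha>" "cpoly (b $ j1)"] assms(1) by auto
  obtain m where m: "order z (cpoly \<alpha>) = Suc m"
    using z(1) assms(1) order_root[of "cpoly \<alpha>" z] not0_implies_Suc by auto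
  obtain j0 where j0: "poly (cpoly (F $ j0)) z \<noteq> 0" using F by blast
  obtain e where e: "recenter z (cpoly \<alpha>) = [:0, 1:] ^ Suc m * e" "coeff e 0 \<noteq> 0"
    using recenter_root_decomp[of "cpoly \<alpha>" z m] assms(1) m by auto
  \<comment> \<open>Taylor expansion at \<open>z\<close> is a ring homomorphism commuting with
    differentiation, so the equation carries over to power series, where everything nonzero at
    \<open>z\<close> is a unit.\<close>
  define S where "S p = fps_of_poly (recenter z (cpoly p))" for p
  have S_mult: "S (p * q) = S p * S q" for p q
    by (simp add: S_def cpoly_mult pcompose_mult fps_of_poly_mult)
  have S_diff: "S (p - q) = S p - S q" for p q
    by (simp add: S_def cpoly_diff pcompose_diff fps_of_poly_diff)
  have S_deriv: "S (pderiv p) = fps_deriv (S p)" for p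
    by (simp add: S_def cpoly_pderiv pderiv_recenter[symmetric] fps_of_poly_pderiv)
  have "\<exists>c. (\<exists>i\<le>Suc m. c i \<noteq> 0) \<and> (\<forall>j. (\<Sum>i\<le>Suc m. c i * fps_nth (S (F $ j)) i) = 0)"
  proof (rule relation_of_fps_derivative)
    show "S \<alpha> = fps_X ^ Suc m * fps_of_poly e"
      unfolding S_def e fps_of_poly_mult fps_of_poly_power by simp
    show "fps_nth (fps_of_poly e) 0 \<noteq> 0" using e by simp
    have "recenter z (cpoly u) \<noteq> 0"
      using assms(2) by (simp add: pcompose_eq_0_iff)
    then show "S u \<noteq> 0" by (metis S_def fps_of_poly_0 fps_of_poly_eq_iff)
    show "S u * (S \<alpha> * fps_deriv (S (b $ j)) - S (b $ j) * fps_deriv (S \<alpha>)) = S w * S (F $ j)" for j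
      using arg_cong[OF deriv[of j], of S] by (simp only: S_mult S_diff S_deriv)
    show "fps_nth (S (F $ j0)) 0 \<noteq> 0" using j0 by (simp add: S_def)
    show "\<not> fps_X ^ Suc m dvd S (b $ j1)"
    proof
      assume "fps_X ^ Suc m dvd S (b $ j1)"
      then obtain g where g: "S (b $ j1) = fps_X ^ Suc m * g" ..
      have "coeff (recenter z (cpoly (b $ j1))) k = 0" if "k < Suc m" for k
      proof -
        have "coeff (recenter z (cpoly (b $ j1))) k = fps_nth (S (b $ j1)) k" by (simp add: S_def)
        then show ?thesis using that by (simp only: g fps_X_power_mult_nth if_True)
      qed
      then have "monom 1 (Suc m) dvd recenter z (cpoly (b $ j1))"
        by (simp only: monom_1_dvd_iff') blast
      then have "recenter z ([:- z, 1:] ^ Suc m) dvd recenter z (cpoly (b $ j1))"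
        unfolding recenter_power_linear by (simp only: monom_altdef smult_1_left)
      then show False using z(2) unfolding recenter_dvd_iff m by blast
    qed
  qed blast
  then have "family_dependent (map (taylor_vector F z) [0..<Suc (order z (cpoly \<alpha>))])"
    unfolding family_dependent_iff m taylor_vector_nth by (simp add: S_def)
  with z(1) that show thesis by blast
qed

text \<open>The root \<open>z\<close> may be non-real, so the construction at \<open>z\<close> first
  gives a complex curve \<open>D\<close>. As \<open>\<alpha>\<close> and \<open>F\<close> are real,
  its real and imaginary parts solve the equation separately, and at least one of them is not
  divisible by \<open>\<alpha>\<close>.\<close>

lemma relation_imp_framing:
  fixes F :: "real poly ^ 3"
  assumes "\<alpha> \<noteq> 0" "poly (cpoly \<alpha>) z = 0" and F: "poly (cpoly (F $ j0)) z \<noteq> 0"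
    and dep: "family_dependent (map (taylor_vector F z) [0..<Suc (order z (cpoly \<alpha>))])"
  obtains b :: "real poly ^ 3" and w j1
  where "\<And>j. \<alpha> * pderiv (b $ j) - b $ j * pderiv \<alpha> = w * F $ j" "\<not> \<alpha> dvd b $ j1"
proof -
  obtain m where m: "order z (cpoly \<alpha>) = Suc m"
    using assms(1,2) order_root[of "cpoly \<alpha>" z] not0_implies_Suc by auto
  obtain e where e: "recenter z (cpoly \<alpha>) = [:0, 1:] ^ Suc m * e" "coeff e 0 \<noteq> 0"
    using recenter_root_decomp[of "cpoly \<alpha>" z m] assms(1) m by auto
  obtain c where c: "\<exists>i\<le>Suc m. c i \<noteq> 0"
      "\<And>j. (\<Sum>i\<le>Suc m. c i * coeff (recenter z (cpoly (F $ j))) i) = 0"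
    using dep unfolding m family_dependent_iff taylor_vector_nth by blast
  have "e \<noteq> 0" "coeff (recenter z (cpoly (F $ j0))) 0 \<noteq> 0" using e F by auto
  from poly_derivative_of_relation[where F = "\<lambda>j. recenter z (cpoly (F $ j))", OF e(1) this c]
  obtain B W j1 where B: "\<And>j. recenter z (cpoly \<alpha>) * pderiv (B j) - B j * pderiv (recenter z (cpoly \<alpha>))
      = W * recenter z (cpoly (F $ j))" "\<not> recenter z (cpoly \<alpha>) dvd B j1"
    by metis
  define D where "D j = recenter (- z) (B j)" for j
  define w where "w = recenter (- z) W"
  have D: "cpoly \<alpha> * pderiv (D j) - D j * pderiv (cpoly \<alpha>) = cpoly (F $ j) * w" for j
    using arg_cong[OF B(1)[of j], of "recenter (- z)"]
    by (simp add: pcompose_diff pcompose_mult pderiv_recenter[symmetric] D_def w_def mult.commute)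
  have nd: "\<not> cpoly \<alpha> dvd D j1"
    using B(2) recenter_dvd_iff[of "recenter z (cpoly \<alpha>)" "- z" "B j1"] by (simp add: D_def)
  have D': "cpoly \<alpha> * pderiv (D j) - cpoly (pderiv \<alpha>) * D j = cpoly (F $ j) * w" for j
    using D[of j] by (simp add: cpoly_pderiv mult.commute)
  consider "\<not> \<alpha> dvd map_poly Re (D j1)" | "\<not> \<alpha> dvd map_poly Im (D j1)"
  proof -
    have "cpoly \<alpha> dvd D j1" if "\<alpha> dvd map_poly Re (D j1)" "\<alpha> dvd map_poly Im (D j1)"
      using that by (subst cpoly_Re_Im) (intro dvd_add dvd_smult, simp_all add: cpoly_dvd_iff)
    with nd that show thesis by blast
  qed
  then show thesis
  proof cases
    case 1
    show thesis
    proof (rule that)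
      show "\<alpha> * pderiv ((\<chi> j. map_poly Re (D j)) $ j) - (\<chi> j. map_poly Re (D j)) $ j * pderiv \<alpha>
          = map_poly Re w * F $ j" for j
        using arg_cong[OF D'[of j], of "map_poly Re"]
        unfolding map_poly_Re_diff map_poly_Re_cpoly_mult map_poly_Re_pderiv
        by (simp add: mult.commute)
      show "\<not> \<alpha> dvd (\<chi> j. map_poly Re (D j)) $ j1" using 1 by simp
    qed
  next
    case 2
    show thesis
    proof (rule that)
      show "\<alpha> * pderiv ((\<chi> j. map_poly Im (D j)) $ j) - (\<chi> j. map_poly Im (D j)) $ j * pderiv \<alpha>
          = map_poly Im w * F $ j" for j
        using arg_cong[OF D'[of j], of "map_poly Im"]
        unfolding map_poly_Im_diff map_poly_Im_cpoly_mult map_poly_Im_pderiv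
        by (simp add: mult.commute)
      show "\<not> \<alpha> dvd (\<chi> j. map_poly Im (D j)) $ j1" using 2 by simp
    qed
  qed
qed

theorem theorem4p6:
  fixes \<alpha> :: "real poly" and A :: "real poly quat"
  assumes "\<alpha> \<noteq> 0" and "reduced_wrt_i A"
  shows "((\<exists>b :: real poly quat.
             framing_motion_polynomial \<alpha> b A \<and>
             rational_PH_curve (origin_trajectory (dual_scaled \<alpha> b A)) \<and>
             \<not> polynomial_curve (origin_trajectory (dual_scaled \<alpha> b A)))
          \<longleftrightarrow>
          (\<exists>(z :: complex) n. poly (map_poly complex_of_real \<alpha>) z = 0 \<and>
             n = order z (map_poly complex_of_real \<alpha>) \<and> n \<ge> 1 \<and>
             family_dependent (map (taylor_vector (qvec (rotated_i A)) z) [0..<Suc n])))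
         \<and>
         (\<forall>(z :: complex) n. poly (map_poly complex_of_real \<alpha>) z = 0 \<and>
             n = order z (map_poly complex_of_real \<alpha>) \<and> n \<ge> 3 \<longrightarrow>
             family_dependent (map (taylor_vector (qvec (rotated_i A)) z) [0..<Suc n]))"
    (is "(?framing \<longleftrightarrow> ?relation) \<and> ?large")
proof (intro conjI iffI)
  let ?F = "qvec (rotated_i A)"
  have "A \<noteq> 0" using assms(2) by (rule reduced_wrt_i_nonzero)
  \<comment> \<open>Reducedness provides the local unit needed at every root of
    \<open>\<alpha>\<close>.\<close>
  have F: "\<exists>j. poly (cpoly (?F $ j)) z \<noteq> 0" for z
    using rotated_i_no_complex_zero[OF assms(2)] by metis
  then have "?F \<noteq> 0" by (metis map_poly_0 poly_0 zero_index)
  note framing = framing_iff[OF assms(1) \<open>A \<noteq> 0\<close> \<open>?F \<noteq> 0\<close>]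
    and polynomial = polynomial_curve_trajectory_iff[OF assms(1) \<open>A \<noteq> 0\<close>]
  show ?relation if ?framing
  proof -
    from that obtain b u w j1 where "u \<noteq> 0" "\<not> \<alpha> dvd qvec b $ j1"
        "\<And>j. u * (\<alpha> * pderiv (qvec b $ j) - qvec b $ j * pderiv \<alpha>) = w * ?F $ j"
      unfolding framing polynomial by blast
    then obtain z where z: "poly (cpoly \<alpha>) z = 0"
        "family_dependent (map (taylor_vector ?F z) [0..<Suc (order z (cpoly \<alpha>))])"
      using framing_imp_relation[OF assms(1) _ _ F] by metis
    then have "order z (cpoly \<alpha>) \<ge> 1"
      using assms(1) order_root[of "cpoly \<alpha>" z] by auto
    with z show ?relation by blast
  qed
  show ?framing if ?relation
  proof -
    from that obtain z where z: "poly (cpoly \<alpha>) z = 0"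
        "family_dependent (map (taylor_vector ?F z) [0..<Suc (order z (cpoly \<alpha>))])"
      by blast
    obtain j0 where "poly (cpoly (?F $ j0)) z \<noteq> 0" using F by blast
    from relation_imp_framing[OF assms(1) z(1) this z(2)]
    obtain b :: "real poly ^ 3" and w j1
      where b: "\<And>j. \<alpha> * pderiv (b $ j) - b $ j * pderiv \<alpha> = w * ?F $ j" "\<not> \<alpha> dvd b $ j1"
      by metis
    define q where "q = Quat 0 (b $ 1) (b $ 2) (b $ 3)"
    have q: "qvec q = b" by (simp add: q_def vec_eq_iff forall_3)
    have "vectorial q" by (simp add: vectorial_def quat_eq_iff q_def)
    moreover have "\<exists>u w. u \<noteq> 0 \<and> (\<forall>j. u * (\<alpha> * pderiv (b $ j) - b $ j * pderiv \<alpha>) = w * ?F $ j)"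
      using b(1) by (intro exI[of _ 1] exI[of _ w]) simp
    ultimately have "framing_motion_polynomial \<alpha> q A" by (simp add: framing q)
    moreover from this have "rational_PH_curve (origin_trajectory (dual_scaled \<alpha> q A))"
      using \<open>?F \<noteq> 0\<close> by (rule framing_imp_PH)
    ultimately show ?framing using b(2) unfolding polynomial by (metis q)
  qed
  \<comment> \<open>For \<open>n \<ge> 3\<close> the family has \<open>n + 1\<close>, hence at least
    four, vectors in a space of dimension three.\<close>
  show ?large
    by (intro allI impI family_dependent_if_length_gt) auto
qed

end
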